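(* Let $G$ be a finite group such that $\Gamma(G)$ consists of exactly one triangle (that is, $\Gamma(G)$ has exactly three vertices and they are pairwise adjacent). Then $G\cong Q_8$ or $G\cong D_8$.
   Context: For a finite group $G$, $\Gamma(G)$ is the graph whose vertices are the non-central conjugacy classes of $G$ (those of cardinality bigger than $1$), two distinct vertices being joined by an edge if their cardinalities are not coprime. $Q_8$ is the quaternion group of order 8 and $D_8$ is the dihedral group of order 8. *)

theory Defs
  imports "HOL-Algebra.Group_Action" "Graph_Theory.Graph_Theory"
begin

text \<open>The orbits of the conjugation action, in the form used by \<open>action_by_conjugation\<close>.\<close>

definition conjugacy_classes :: "('a, 'b) monoid_scheme \<Rightarrow> 'a set set" where
  "conjugacy_classes G =
     orbits G (carrier G) (\<lambda>g. \<lambda>h \<in> carrier G. g \<otimes>\<^bsub>G\<^esub> h \<otimes>\<^bsub>G\<^esub> inv\<^bsub>G\<^esub> g)"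

definition noncentral_classes :: "('a, 'b) monoid_scheme \<Rightarrow> 'a set set" where
  "noncentral_classes G = {C \<in> conjugacy_classes G. card C > 1}"

text \<open>An undirected edge is represented by the two opposite arcs.\<close>

definition class_graph :: "('a, 'b) monoid_scheme \<Rightarrow> 'a set pair_pre_digraph" where
  "class_graph G =
     \<lparr> pverts = noncentral_classes G,
       parcs = {(C, D). C \<in> noncentral_classes G \<and> D \<in> noncentral_classes G \<and>
                        C \<noteq> D \<and> \<not> coprime (card C) (card D)} \<rparr>"

text \<open>
  The dihedral group of order \<open>2n\<close>, for positive \<open>n\<close>. The pair \<open>(i, b)\<close> stands for
  \<open>r\<^sup>i s\<^sup>b\<close>, where \<open>r\<close> is a rotation of order \<open>n\<close> and \<open>s\<close> is a reflection, so that
  \<open>s r\<^sup>j = r\<^sup>-\<^sup>j s\<close>.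
\<close>

definition dihedral_group :: "nat \<Rightarrow> (int \<times> bool) monoid" where
  "dihedral_group n =
     \<lparr> carrier = {0..<int n} \<times> UNIV,
       monoid.mult = (\<lambda>(i, b) (j, c). ((if b then i - j else i + j) mod int n, b \<noteq> c)),
       one = (0, False) \<rparr>"

text \<open>The index is the order of the group, so this is the symmetry group of the square.\<close>

definition D8 :: "(int \<times> bool) monoid" where
  "D8 = dihedral_group 4"

text \<open>The tuple \<open>(a, b, c, d)\<close> stands for the quaternion \<open>a + b i + c j + d k\<close>.\<close>

fun hamilton_mult ::
  "int \<times> int \<times> int \<times> int \<Rightarrow> int \<times> int \<times> int \<times> int \<Rightarrow> int \<times> int \<times> int \<times> int" where
  "hamilton_mult (a, b, c, d) (a', b', c', d') =
     (a * a' - b * b' - c * c' - d * d',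
      a * b' + b * a' + c * d' - d * c',
      a * c' - b * d' + c * a' + d * b',
      a * d' + b * c' - c * b' + d * a')"

definition Q8 :: "(int \<times> int \<times> int \<times> int) monoid" where
  "Q8 =
     \<lparr> carrier = {(1, 0, 0, 0), (-1, 0, 0, 0), (0, 1, 0, 0), (0, -1, 0, 0),
                  (0, 0, 1, 0), (0, 0, -1, 0), (0, 0, 0, 1), (0, 0, 0, -1)},
       monoid.mult = hamilton_mult,
       one = (1, 0, 0, 0) \<rparr>"

lemma group_dihedral_group:
  assumes "n > 0"
  shows "group (dihedral_group n)"
proof (rule groupI)
  fix x assume "x \<in> carrier (dihedral_group n)"
  then obtain i b where x: "x = (i, b)" "0 \<le> i" "i < int n"
    by (auto simp: dihedral_group_def)
  have "(if b then i else (- i) mod int n, b) \<in> carrier (dihedral_group n)"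
    using x assms by (auto simp: dihedral_group_def)
  moreover have "(if b then i else (- i) mod int n, b) \<otimes>\<^bsub>dihedral_group n\<^esub> x = \<one>\<^bsub>dihedral_group n\<^esub>"
    using x by (auto simp: dihedral_group_def mod_simps)
  ultimately show "\<exists>y \<in> carrier (dihedral_group n). y \<otimes>\<^bsub>dihedral_group n\<^esub> x = \<one>\<^bsub>dihedral_group n\<^esub>"
    by blast
qed (use assms in \<open>auto simp: dihedral_group_def mod_simps algebra_simps\<close>)

lemma order_dihedral_group: "order (dihedral_group n) = 2 * n"
  by (simp add: dihedral_group_def order_def card_cartesian_product)

lemma group_D8: "group D8"
  by (simp add: D8_def group_dihedral_group)

lemma order_D8: "order D8 = 8"
  by (simp add: D8_def order_dihedral_group)

lemma group_Q8: "group Q8"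
proof (rule groupI)
  fix x y z
  show "x \<otimes>\<^bsub>Q8\<^esub> y \<otimes>\<^bsub>Q8\<^esub> z = x \<otimes>\<^bsub>Q8\<^esub> (y \<otimes>\<^bsub>Q8\<^esub> z)"
    by (cases x; cases y; cases z) (simp add: Q8_def algebra_simps)
next
  fix x y assume "x \<in> carrier Q8" "y \<in> carrier Q8"
  then show "x \<otimes>\<^bsub>Q8\<^esub> y \<in> carrier Q8"
    by (auto simp: Q8_def)
qed (auto simp: Q8_def)

lemma order_Q8: "order Q8 = 8"
  by (simp add: Q8_def order_def)

end

theory Submission
  imports Defs "HOL-Algebra.Sylow" "HOL-Algebra.Multiplicative_Group"
begin

text \<open>
  Only three noncentral classes occur, so the class equation has very few terms and size estimates
  decide almost everything. The order of the centre separates two cases.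

  If the centre is nontrivial, each noncentral class has at most half as many elements as the index
  of the centre. Three such classes are then too small to fill the group unless its order is 8
  (\<open>order_8_if_three_noncentral_classes\<close>), and a nonabelian group of order 8 is determined by an
  element \<open>r\<close> of order 4 together with the square, \<open>\<one>\<close> or \<open>r\<^sup>2\<close>, of an element outside the powers of
  \<open>r\<close> (\<open>nonabelian_order_8_cases\<close>). The adjacency of the vertices is what excludes a trivial centre.

  If the centre is trivial (\<open>center_nontrivial_if_three_noncoprime_classes\<close>), the class sizes have no
  common prime factor, so their pairwise common factors involve three distinct primes \<open>p\<close>, \<open>q\<close>, \<open>r\<close>
  dividing the order of the group. The three classes must then be those of elements of orders
  \<open>p\<close>, \<open>q\<close> and \<open>r\<close>, the centralizers are groups of prime power order for these primes, and the class
  equation writes 1 as a sum of four unit fractions in which one of the three centralizer orders has to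
  be 2 (\<open>egyptian_fraction_has_2\<close>). An involution whose centralizer has order 2 inverts the complement
  of its class, which is therefore commutative (\<open>commute_outside_class_if_centralizer_2\<close>); but that
  complement contains elements of the two other prime orders, whose product would have composite
  order.
\<close>

section \<open>Conjugacy classes, centralizers and the centre\<close>

context group
begin

definition conj_class :: "'a \<Rightarrow> 'a set" where
  "conj_class x = {g \<otimes> x \<otimes> inv g | g. g \<in> carrier G}"

definition centralizer :: "'a \<Rightarrow> 'a set" where
  "centralizer x = {g \<in> carrier G. g \<otimes> x = x \<otimes> g}"

definition center :: "'a set" where
  "center = {x \<in> carrier G. \<forall>g \<in> carrier G. g \<otimes> x = x \<otimes> g}"

lemma conj_eq_iff:
  assumes "g \<in> carrier G" "x \<in> carrier G" "y \<in> carrier G"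
  shows "g \<otimes> x \<otimes> inv g = y \<longleftrightarrow> g \<otimes> x = y \<otimes> g"
  using assms by (metis inv_closed inv_solve_right m_closed)

lemma orbit_conjugation:
  assumes "x \<in> carrier G"
  shows "Group_Action.orbit G (\<lambda>g. \<lambda>h \<in> carrier G. g \<otimes> h \<otimes> inv g) x = conj_class x"
  using assms by (auto simp: Group_Action.orbit_def conj_class_def)

lemma conjugacy_classes_eq: "conjugacy_classes G = conj_class ` carrier G"
  unfolding conjugacy_classes_def orbits_def using orbit_conjugation by auto

lemma stabilizer_conjugation:
  assumes "x \<in> carrier G"
  shows "stabilizer G (\<lambda>g. \<lambda>h \<in> carrier G. g \<otimes> h \<otimes> inv g) x = centralizer x"
  unfolding stabilizer_def centralizer_def
  by (rule Collect_cong) (use assms conj_eq_iff[of _ x x] in auto)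

lemma card_conj_class_mult_card_centralizer:
  assumes "x \<in> carrier G"
  shows "card (conj_class x) * card (centralizer x) = order G"
  using group_action.orbit_stabilizer_theorem[OF action_by_conjugation assms]
  by (simp only: orbit_conjugation[OF assms] stabilizer_conjugation[OF assms])

lemma conj_class_self:
  assumes "x \<in> carrier G"
  shows "x \<in> conj_class x"
proof -
  have "x = \<one> \<otimes> x \<otimes> inv \<one>"
    using assms by simp
  then show ?thesis
    unfolding conj_class_def using one_closed by blast
qed

lemma conj_class_subset: "x \<in> carrier G \<Longrightarrow> conj_class x \<subseteq> carrier G"
  by (auto simp: conj_class_def)

lemma conj_class_eq:
  assumes "x \<in> carrier G" "y \<in> conj_class x"
  shows "conj_class y = conj_class x"
proof -
  interpret A: group_action G "carrier G" "\<lambda>g. \<lambda>h \<in> carrier G. g \<otimes> h \<otimes> inv g"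
    by (rule action_by_conjugation)
  have trans: "w \<in> conj_class u" if "u \<in> carrier G" "v \<in> conj_class u" "w \<in> conj_class v" for u v w
  proof -
    have "v \<in> carrier G" "w \<in> carrier G"
      using that conj_class_subset by blast+
    then show ?thesis
      using that A.orbit_trans[of u v w] by (simp add: orbit_conjugation)
  qed
  have y: "y \<in> carrier G"
    using assms conj_class_subset by blast
  then have "x \<in> conj_class y"
    using assms A.orbit_sym[of x y] by (simp add: orbit_conjugation)
  then show ?thesis
    using trans assms y by blast
qed

lemma subgroup_centralizer:
  assumes "x \<in> carrier G"
  shows "subgroup (centralizer x) G"
  using group_action.stabilizer_subgroup[OF action_by_conjugation assms]
  by (simp only: stabilizer_conjugation[OF assms])

lemma one_mem_center: "\<one> \<in> center"
  by (simp add: center_def)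

lemma subgroup_center: "subgroup center G"
proof -
  have "center = \<Inter> (centralizer ` carrier G)"
  proof
    show "\<Inter> (centralizer ` carrier G) \<subseteq> center"
    proof
      fix x assume x: "x \<in> \<Inter> (centralizer ` carrier G)"
      then have "x \<in> carrier G"
        using one_closed unfolding centralizer_def by blast
      moreover have "g \<otimes> x = x \<otimes> g" if "g \<in> carrier G" for g
        using x that by (force simp: centralizer_def)
      ultimately show "x \<in> center"
        by (simp add: center_def)
    qed
  qed (auto simp: center_def centralizer_def)
  then show ?thesis
    using subgroups_Inter[of "centralizer ` carrier G"] subgroup_centralizer by auto
qed

lemma conj_class_of_center: "x \<in> center \<Longrightarrow> conj_class x = {x}"
proof -
  assume x: "x \<in> center"
  then have "g \<otimes> x \<otimes> inv g = x" if "g \<in> carrier G" for g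
    using that by (subst conj_eq_iff) (auto simp: center_def)
  moreover have "x \<in> conj_class x"
    using x conj_class_self by (simp add: center_def)
  ultimately show ?thesis
    unfolding conj_class_def by auto
qed

lemma center_if_conj_class_singleton:
  assumes "x \<in> carrier G" "conj_class x = {x}"
  shows "x \<in> center"
proof -
  have "g \<otimes> x \<otimes> inv g = x" if "g \<in> carrier G" for g
    using assms that by (auto simp: conj_class_def)
  then show ?thesis
    using assms by (auto simp: center_def conj_eq_iff)
qed

lemma noncentral_classes_eq:
  assumes "finite (carrier G)"
  shows "noncentral_classes G = conj_class ` (carrier G - center)"
proof -
  have "card (conj_class x) > 1 \<longleftrightarrow> x \<notin> center" if x: "x \<in> carrier G" for x
  proof
    assume "x \<notin> center"
    then have "conj_class x \<noteq> {x}"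
      using center_if_conj_class_singleton x by blast
    moreover have "finite (conj_class x)"
      using conj_class_subset[OF x] assms finite_subset by blast
    ultimately show "card (conj_class x) > 1"
      using conj_class_self[OF x]
      by (metis One_nat_def Suc_lessI card_1_singletonE card_gt_0_iff empty_iff singletonD)
  qed (use conj_class_of_center in fastforce)
  then show ?thesis
    by (auto simp: noncentral_classes_def conjugacy_classes_eq)
qed

lemma class_equation:
  assumes "finite (carrier G)"
  shows "order G = card center + (\<Sum>C \<in> noncentral_classes G. card C)"
proof -
  have nc: "conj_class x \<subseteq> carrier G - center" if "x \<in> carrier G - center" for x
  proof -
    have "y \<notin> center" if "y \<in> conj_class x" for y
      using that \<open>x \<in> carrier G - center\<close> conj_class_eq[of x y] conj_class_of_center[of y]
        conj_class_self[of x] by auto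
    then show ?thesis using that conj_class_subset by auto
  qed
  have U: "\<Union> (noncentral_classes G) = carrier G - center"
    unfolding noncentral_classes_eq[OF assms] using nc conj_class_self by blast
  have "card (\<Union> (noncentral_classes G)) = (\<Sum>C \<in> noncentral_classes G. card C)"
  proof (rule card_Union_disjoint)
    show "pairwise disjnt (noncentral_classes G)"
      unfolding noncentral_classes_eq[OF assms] pairwise_def disjnt_def
      using conj_class_eq by blast
    show "finite C" if "C \<in> noncentral_classes G" for C
      using that U assms by (metis Union_upper finite_Diff finite_subset)
  qed
  moreover have "center \<subseteq> carrier G" by (auto simp: center_def)
  ultimately show ?thesis
    using U assms by (metis card_Diff_subset card_mono finite_subset le_add_diff_inverse order_def)
qed

lemma ord_conj_class:
  assumes "x \<in> carrier G" "y \<in> conj_class x"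
  shows "ord y = ord x"
proof -
  obtain g where g: "g \<in> carrier G" and y: "y = g \<otimes> x \<otimes> inv g"
    using assms by (auto simp: conj_class_def)
  have cancel: "inv g \<otimes> (g \<otimes> z) = z" if "z \<in> carrier G" for z
    using g that by (simp flip: m_assoc)
  have pow: "y [^] n = g \<otimes> x [^] n \<otimes> inv g" for n :: nat
  proof (induction n)
    case (Suc n)
    have "y [^] Suc n = g \<otimes> x [^] n \<otimes> inv g \<otimes> (g \<otimes> x \<otimes> inv g)"
      using Suc y by simp
    also have "\<dots> = g \<otimes> x [^] Suc n \<otimes> inv g"
      using g assms by (simp add: m_assoc cancel)
    finally show ?case .
  qed (use g in simp)
  have "y \<in> carrier G"
    using assms conj_class_subset by blast
  moreover have "y [^] n = \<one> \<longleftrightarrow> x [^] n = \<one>" for n :: nat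
    unfolding pow using g assms by (simp add: conj_eq_iff)
  ultimately show ?thesis
    using assms ord_unique pow_eq_id by auto
qed

section \<open>Elements of prime order\<close>

text \<open>Cauchy's theorem, in a form that also applies inside a centralizer.\<close>

lemma cauchy_subgroup:
  assumes fin: "finite (carrier G)" and K: "subgroup K G" and p: "prime p" "p dvd card K"
  shows "\<exists>x \<in> K. ord x = p"
proof -
  interpret K: group "G\<lparr>carrier := K\<rparr>"
    using K subgroup.subgroup_is_group is_group by blast
  obtain m where "card K = p ^ 1 * m"
    using p by auto
  moreover have "finite K"
    using K fin finite_subset subgroup.subset by blast
  ultimately obtain H where H: "subgroup H (G\<lparr>carrier := K\<rparr>)" "card H = p"
    using sylow_thm[OF p(1) K.is_group, of 1 m] by (auto simp: order_def)
  have HG: "subgroup H G" "H \<subseteq> K"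
    using H(1) K incl_subgroup subgroup.subset by fastforce+
  obtain x where x: "x \<in> H" "x \<noteq> \<one>"
    using H(2) p(1) by (metis card_2_iff' card_eq_0_iff finite_subset is_singletonI' is_singleton_altdef
        not_prime_0 not_prime_1 equals0I)
  have xG: "x \<in> carrier G"
    using x HG subgroup.subset by blast
  have "ord x dvd card H"
    using group.pow_order_eq_1[OF subgroup.subgroup_is_group[OF HG(1) is_group], of x] x
      nat_pow_consistent pow_eq_id[OF xG] by (simp add: order_def)
  then have "ord x = p"
    using H(2) p(1) x(2) ord_eq_1[OF xG] by (auto simp: prime_nat_iff)
  then show ?thesis
    using x HG by blast
qed

text \<open>
  If the order of the product is a prime, it is one of the two orders, because it divides their
  product. Raising the product to that power kills one factor but not the other.
\<close>

lemma ord_mult_of_distinct_primes: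
  assumes xy: "x \<in> carrier G" "y \<in> carrier G" "x \<otimes> y = y \<otimes> x"
    and primes: "prime (ord x)" "prime (ord y)" "ord x \<noteq> ord y"
  shows "\<not> prime (ord (x \<otimes> y))"
proof
  assume "prime (ord (x \<otimes> y))"
  then have "ord (x \<otimes> y) = ord x \<or> ord (x \<otimes> y) = ord y"
    using ord_mul_divides[OF xy(3,1,2)] primes by (metis prime_dvd_mult_iff primes_dvd_imp_eq)
  then show False
  proof
    assume *: "ord (x \<otimes> y) = ord x"
    have "(x \<otimes> y) [^] ord x = y [^] ord x"
      using xy by (simp add: pow_mult_distrib)
    then have "y [^] ord x = \<one>"
      using * xy by (metis m_closed pow_ord_eq_1)
    then show False
      using xy primes by (metis pow_eq_id primes_dvd_imp_eq)
  next
    assume *: "ord (x \<otimes> y) = ord y"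
    have "(x \<otimes> y) [^] ord y = x [^] ord y"
      using xy by (simp add: pow_mult_distrib)
    then have "x [^] ord y = \<one>"
      using * xy by (metis m_closed pow_ord_eq_1)
    then show False
      using xy primes by (metis pow_eq_id primes_dvd_imp_eq)
  qed
qed

section \<open>Groups with trivial centre\<close>

text \<open>
  Let \<open>T\<close> be the class of \<open>t\<close>; it fills half of the group and consists of involutions, each with
  centralizer \<open>{\<one>, a}\<close>. A product of two elements of \<open>T\<close> is never in \<open>T\<close>: if it were an involution,
  its factors would commute. Counting shows that \<open>aT\<close> is the complement \<open>H\<close> of \<open>T\<close> for every \<open>a\<close> in
  \<open>T\<close>. Hence \<open>H\<close> is closed under multiplication, and \<open>t\<close> inverts each of its elements since
  \<open>t (t b) t = b t = (t b)\<^sup>-\<^sup>1\<close>. Inversion on \<open>H\<close>, being a conjugation, is then multiplicative, which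
  forces \<open>H\<close> to be commutative.
\<close>

lemma commute_outside_class_if_centralizer_2:
  assumes fin: "finite (carrier G)" and t: "t \<in> carrier G" "t \<noteq> \<one>" "card (centralizer t) = 2"
    and y: "y \<in> carrier G - conj_class t" and w: "w \<in> carrier G - conj_class t"
  shows "y \<otimes> w = w \<otimes> y"
proof -
  let ?T = "conj_class t"
  have TG: "?T \<subseteq> carrier G"
    using t conj_class_subset by blast
  then have finT: "finite ?T"
    using fin finite_subset by blast
  have cardT: "card ?T * 2 = order G"
    using card_conj_class_mult_card_centralizer t by metis
  have one: "\<one> \<notin> ?T"
    using conj_class_eq[of t \<one>] conj_class_of_center[OF one_mem_center] conj_class_self[of t] t by auto
  have cent: "centralizer a = {\<one>, a}" if a: "a \<in> ?T" for a
  proof -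
    have aG: "a \<in> carrier G" using a TG by blast
    have "card ?T * card (centralizer a) = card ?T * 2"
      using card_conj_class_mult_card_centralizer[OF aG] conj_class_eq[OF t(1) a] cardT by simp
    moreover have "card ?T \<noteq> 0"
      using a finT by auto
    ultimately have "card (centralizer a) = 2" by simp
    moreover have "{\<one>, a} \<subseteq> centralizer a" "card {\<one>, a} = 2"
      using aG one a by (auto simp: centralizer_def card_insert_if)
    ultimately show ?thesis
      by (metis card_subset_eq card.infinite zero_neq_numeral)
  qed
  have invol: "a \<otimes> a = \<one>" if a: "a \<in> ?T" for a
  proof -
    have aG: "a \<in> carrier G" using a TG by blast
    then have "a \<otimes> a \<in> centralizer a"
      by (simp add: centralizer_def m_assoc)
    then have "a \<otimes> a = \<one> \<or> a \<otimes> a = a"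
      using cent[OF a] by simp
    then show ?thesis
      using aG l_cancel_one' one a by metis
  qed
  have prod: "a \<otimes> b \<notin> ?T" if a: "a \<in> ?T" and b: "b \<in> ?T" for a b
  proof
    assume ab: "a \<otimes> b \<in> ?T"
    have G: "a \<in> carrier G" "b \<in> carrier G" using a b TG by auto
    have "a \<otimes> b = inv (a \<otimes> b)"
      using invol[OF ab] G by (metis inv_equality m_closed)
    also have "\<dots> = b \<otimes> a"
      using invol[OF a] invol[OF b] G by (metis inv_equality inv_mult_group)
    finally have "b \<in> centralizer a"
      using G by (simp add: centralizer_def)
    then show False
      using cent[OF a] ab invol[OF a] one b by auto
  qed
  have coset: "(\<lambda>b. a \<otimes> b) ` ?T = carrier G - ?T" if a: "a \<in> ?T" for a
  proof (rule card_subset_eq)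
    show "finite (carrier G - ?T)" using fin by simp
    show "(\<lambda>b. a \<otimes> b) ` ?T \<subseteq> carrier G - ?T"
      using prod[OF a] a TG by auto
    have "inj_on (\<lambda>b. a \<otimes> b) ?T"
      using a TG by (auto simp: inj_on_def subset_iff)
    then have "card ((\<lambda>b. a \<otimes> b) ` ?T) = card ?T"
      by (rule card_image)
    also have "\<dots> = card (carrier G - ?T)"
      using cardT TG finT by (simp add: card_Diff_subset order_def)
    finally show "card ((\<lambda>b. a \<otimes> b) ` ?T) = card (carrier G - ?T)" .
  qed
  have tT: "t \<in> ?T" using t conj_class_self by blast
  have inverted: "t \<otimes> h \<otimes> t = inv h" if h: "h \<in> carrier G - ?T" for h
  proof -
    obtain b where b: "b \<in> ?T" "h = t \<otimes> b"
      using h coset[OF tT] by blast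
    have bG: "b \<in> carrier G" using b TG by auto
    have "t \<otimes> h \<otimes> t = t \<otimes> t \<otimes> b \<otimes> t"
      using b bG t by (simp add: m_assoc)
    also have "\<dots> = b \<otimes> t"
      using invol[OF tT] bG t by simp
    also have "\<dots> = inv h"
      using invol[OF tT] invol[OF b(1)] bG t b by (metis inv_equality inv_mult_group)
    finally show ?thesis .
  qed
  (* Factoring w through the same b that occurs in y makes the two copies of b cancel in y w. *)
  obtain b where b: "b \<in> ?T" "y = t \<otimes> b"
    using y coset[OF tT] by blast
  obtain c where c: "c \<in> ?T" "w = b \<otimes> c"
    using w coset[OF b(1)] by blast
  have G: "b \<in> carrier G" "c \<in> carrier G" "y \<in> carrier G" "w \<in> carrier G"
    using b c y w TG by auto
  have "y \<otimes> w = t \<otimes> (b \<otimes> b) \<otimes> c"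
    using b(2) c(2) G t by (simp add: m_assoc)
  then have "y \<otimes> w = t \<otimes> c"
    using invol[OF b(1)] t by simp
  then have yw: "y \<otimes> w \<in> carrier G - ?T"
    using coset[OF tT] c by blast
  have "inv w \<otimes> inv y = t \<otimes> (y \<otimes> w) \<otimes> t"
    using inverted[OF yw] G by (simp add: inv_mult_group)
  also have "\<dots> = (t \<otimes> y \<otimes> t) \<otimes> (t \<otimes> w \<otimes> t)"
  proof -
    have "(t \<otimes> y \<otimes> t) \<otimes> (t \<otimes> w \<otimes> t) = t \<otimes> y \<otimes> (t \<otimes> t) \<otimes> w \<otimes> t"
      using G t by (simp add: m_assoc)
    then show ?thesis
      using invol[OF tT] G t by (simp add: m_assoc)
  qed
  also have "\<dots> = inv y \<otimes> inv w"
    using inverted[OF y] inverted[OF w] by simp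
  finally have "inv (y \<otimes> w) = inv (w \<otimes> y)"
    using G by (simp add: inv_mult_group)
  then show ?thesis
    using G by (metis inv_inv m_closed)
qed

end

text \<open>
  Dividing by \<open>n\<close>, the assumptions read \<open>1 = 1/n + 1/a + 1/b + 1/c\<close>. Distinct denominators that are
  all at least 3 contribute at most \<open>1/3 + 1/4 + 1/5 = 47/60\<close>, and the largest of them divides \<open>n\<close>, so
  \<open>1/n \<le> 1/5\<close>; the total is at most 59/60.
\<close>

lemma egyptian_fraction_has_2:
  fixes a b c k l m n :: nat
  assumes "n = k * a" "n = l * b" "n = m * c" "n = 1 + k + l + m"
    and "a \<ge> 2" "b \<ge> 2" "c \<ge> 2" "a \<noteq> b" "a \<noteq> c" "b \<noteq> c"
  shows "a = 2 \<or> b = 2 \<or> c = 2"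
proof (rule ccontr)
  have sorted: False
    if n: "n = k * a" "n = l * b" "n = m * c" "n = 1 + k + l + m"
      and ord: "3 \<le> a" "a < b" "b < c" for a b c k l m
  proof -
    have "3 * k \<le> n" "4 * l \<le> n" "5 * m \<le> n"
      using n ord mult_le_mono2[of 3 a k] mult_le_mono2[of 4 b l] mult_le_mono2[of 5 c m] by linarith+
    moreover have "m \<noteq> 0" using n by (intro notI) simp
    ultimately show False using n(4) by linarith
  qed
  assume "\<not> (a = 2 \<or> b = 2 \<or> c = 2)"
  then have ge: "3 \<le> a" "3 \<le> b" "3 \<le> c"
    using assms by auto
  consider "a < b" "b < c" | "a < c" "c < b" | "b < a" "a < c" | "b < c" "c < a"
    | "c < a" "a < b" | "c < b" "b < a"
    using assms(8-10) by linarith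
  then show False
  proof cases
    case 1 then show ?thesis using sorted[of k a l b m c] assms(1-4) ge by simp
  next
    case 2 then show ?thesis using sorted[of k a m c l b] assms(1-4) ge by simp
  next
    case 3 then show ?thesis using sorted[of l b k a m c] assms(1-4) ge by simp
  next
    case 4 then show ?thesis using sorted[of l b m c k a] assms(1-4) ge by simp
  next
    case 5 then show ?thesis using sorted[of m c k a l b] assms(1-4) ge by simp
  next
    case 6 then show ?thesis using sorted[of m c l b k a] assms(1-4) ge by simp
  qed
qed


context group
begin

text \<open>
  If these classes exhausted the group, all elements other than \<open>\<one>\<close> would have prime order, so
  elements of distinct prime orders could not commute. By Cauchy's theorem the centralizer of an
  element of order \<open>p\<close> is then a \<open>p\<close>-group, and the three centralizers have distinct orders. The class
  equation becomes an Egyptian fraction, which gives one centralizer of order 2. Outside the class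
  of that involution the group is commutative, and the other two representatives lie there.
  Arithmetic alone would not be enough: \<open>1 = 1/42 + 1/2 + 1/3 + 1/7\<close>.
\<close>

lemma not_three_classes_of_distinct_prime_orders:
  assumes fin: "finite (carrier G)"
    and x: "x \<in> carrier G" "prime (ord x)"
    and y: "y \<in> carrier G" "prime (ord y)"
    and w: "w \<in> carrier G" "prime (ord w)"
    and distinct: "ord x \<noteq> ord y" "ord x \<noteq> ord w" "ord y \<noteq> ord w"
  shows "carrier G \<noteq> insert \<one> (conj_class x \<union> conj_class y \<union> conj_class w)"
proof
  assume cover: "carrier G = insert \<one> (conj_class x \<union> conj_class y \<union> conj_class w)"
  have prime_ord: "prime (ord u)" if "u \<in> carrier G" "u \<noteq> \<one>" for u
  proof -
    have "u \<in> conj_class x \<or> u \<in> conj_class y \<or> u \<in> conj_class w"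
      using that cover by blast
    then show ?thesis
      using ord_conj_class x y w by metis
  qed
  have not_commute: "u \<otimes> v \<noteq> v \<otimes> u"
    if "u \<in> carrier G" "v \<in> carrier G" "prime (ord u)" "prime (ord v)" "ord u \<noteq> ord v" for u v
  proof
    assume "u \<otimes> v = v \<otimes> u"
    then have "\<not> prime (ord (u \<otimes> v))"
      using that ord_mult_of_distinct_primes by blast
    then have "u \<otimes> v = \<one>"
      using prime_ord that by blast
    then have "u = inv v"
      using that by (metis inv_equality)
    then show False
      using that by simp
  qed
  have centralizer_ge_2: "card (centralizer u) \<ge> 2" if "u \<in> carrier G" "prime (ord u)" for u
  proof -
    have "{\<one>, u} \<subseteq> centralizer u" "finite (centralizer u)"
      using that fin by (auto simp: centralizer_def)
    moreover have "\<one> \<noteq> u"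
      using that by auto
    ultimately show ?thesis
      by (metis card_2_iff card_mono)
  qed
  have centralizer_primes: "l = ord u"
    if u: "u \<in> carrier G" "prime (ord u)" and l: "prime l" "l dvd card (centralizer u)" for u l
  proof -
    obtain v where v: "v \<in> centralizer u" "ord v = l"
      using cauchy_subgroup[OF fin subgroup_centralizer[OF u(1)] l] by blast
    then have "v \<in> carrier G" "v \<otimes> u = u \<otimes> v"
      by (auto simp: centralizer_def)
    then show ?thesis
      using not_commute[of v u] u l v by metis
  qed
  have centralizer_distinct: "card (centralizer u) \<noteq> card (centralizer v)"
    if u: "u \<in> carrier G" "prime (ord u)" and v: "v \<in> carrier G" "prime (ord v)"
      and "ord u \<noteq> ord v" for u v
  proof
    assume eq: "card (centralizer u) = card (centralizer v)"
    obtain l where "prime l" "l dvd card (centralizer u)"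
      using centralizer_ge_2[OF u] prime_factor_nat[of "card (centralizer u)"] by auto
    then show False
      using centralizer_primes[OF u, of l] centralizer_primes[OF v, of l] eq that by simp
  qed
  have disj: "conj_class u \<inter> conj_class v = {}"
    if "u \<in> carrier G" "v \<in> carrier G" "ord u \<noteq> ord v" for u v
    using that ord_conj_class[of u] ord_conj_class[of v] by fastforce
  have fin_class: "finite (conj_class u)" if "u \<in> carrier G" for u
    using conj_class_subset[OF that] fin finite_subset by blast
  have one_notin: "\<one> \<notin> conj_class u" if "u \<in> carrier G" "prime (ord u)" for u
    using ord_conj_class[OF that(1), of \<one>] that(2) by (metis not_prime_1 ord_id)
  have "order G = 1 + card (conj_class x \<union> conj_class y \<union> conj_class w)"
    unfolding order_def cover using x y w one_notin fin_class by simp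
  also have "card (conj_class x \<union> conj_class y \<union> conj_class w)
      = card (conj_class x) + card (conj_class y) + card (conj_class w)"
    using x y w distinct disj[of x y] disj[of x w] disj[of y w] fin_class
    by (simp add: card_Un_disjoint Int_Un_distrib2)
  finally have "order G = 1 + card (conj_class x) + card (conj_class y) + card (conj_class w)"
    by simp
  then have "card (centralizer x) = 2 \<or> card (centralizer y) = 2 \<or> card (centralizer w) = 2"
    using x y w distinct
    by (intro egyptian_fraction_has_2[of "order G" "card (conj_class x)" _ "card (conj_class y)"
          _ "card (conj_class w)"])
      (simp_all add: card_conj_class_mult_card_centralizer centralizer_ge_2 centralizer_distinct)
  moreover have False
    if t: "t \<in> carrier G" "prime (ord t)" and c: "card (centralizer t) = 2"
      and u: "u \<in> carrier G" "prime (ord u)" and v: "v \<in> carrier G" "prime (ord v)"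
      and d: "ord t \<noteq> ord u" "ord t \<noteq> ord v" "ord u \<noteq> ord v" for t u v
  proof -
    have "t \<noteq> \<one>" using t by auto
    moreover have "u \<notin> conj_class t" "v \<notin> conj_class t"
      using t d ord_conj_class by metis+
    ultimately have "u \<otimes> v = v \<otimes> u"
      using commute_outside_class_if_centralizer_2[OF fin t(1) _ c] u v by blast
    then show False
      using not_commute u v d by blast
  qed
  ultimately show False
    using x y w distinct by metis
qed

text \<open>
  When the centre is trivial, no prime divides all three class sizes: it would divide the order of
  the group, hence also the one central element left over in the class equation. The primes that
  witness the three failures of coprimality are therefore distinct. All of them divide the order of
  the group, so Cauchy's theorem provides elements of three distinct prime orders, which lie in
  three different classes.
\<close>

lemma center_nontrivial_if_three_noncoprime_classes:
  assumes fin: "finite (carrier G)" and card: "card (noncentral_classes G) = 3"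
    and noncoprime: "\<And>C D. C \<in> noncentral_classes G \<Longrightarrow> D \<in> noncentral_classes G \<Longrightarrow>
      C \<noteq> D \<Longrightarrow> \<not> coprime (card C) (card D)"
  shows "card center \<noteq> 1"
proof
  assume c1: "card center = 1"
  then have center: "center = {\<one>}"
    using one_mem_center by (metis card_1_singletonE singletonD)
  obtain C D E where CDE: "noncentral_classes G = {C, D, E}" "C \<noteq> D" "C \<noteq> E" "D \<noteq> E"
    using card by (auto simp: card_3_iff)
  have order: "order G = 1 + card C + card D + card E"
    using class_equation[OF fin] CDE c1 by simp
  have dvd: "card B dvd order G" if "B \<in> noncentral_classes G" for B
    using that card_conj_class_mult_card_centralizer noncentral_classes_eq[OF fin]
    by (metis (no_types, lifting) DiffD1 dvd_triv_left imageE)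
  have common: "\<exists>p. prime p \<and> p dvd m \<and> p dvd n" if "\<not> coprime m n" for m n :: nat
    using that prime_factor_nat[of "gcd m n"] unfolding coprime_iff_gcd_eq_1 by auto
  obtain p where p: "prime p" "p dvd card C" "p dvd card D"
    using common[OF noncoprime[of C D]] CDE by blast
  obtain q where q: "prime q" "q dvd card C" "q dvd card E"
    using common[OF noncoprime[of C E]] CDE by blast
  obtain r where r: "prime r" "r dvd card D" "r dvd card E"
    using common[OF noncoprime[of D E]] CDE by blast
  have no_common: "\<not> (l dvd card C \<and> l dvd card D \<and> l dvd card E)" if "prime l" for l
  proof
    assume l: "l dvd card C \<and> l dvd card D \<and> l dvd card E"
    then have "l dvd order G"
      using dvd[of C] CDE dvd_trans by blast
    then have "l dvd 1"
      using l order by (metis add.assoc dvd_add dvd_add_left_iff)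
    then show False
      using that by simp
  qed
  have distinct: "p \<noteq> q" "p \<noteq> r" "q \<noteq> r"
    using no_common p q r by auto
  have element: "\<exists>x \<in> carrier G. ord x = l" if "prime l" "l dvd card B" "B \<in> {C, D, E}" for l B
    using cauchy_subgroup[OF fin subgroup_self that(1)] that dvd[of B] CDE dvd_trans
    unfolding order_def by blast
  obtain x where x: "x \<in> carrier G" "ord x = p" using element p by blast
  obtain y where y: "y \<in> carrier G" "ord y = q" using element q by blast
  obtain w where w: "w \<in> carrier G" "ord w = r" using element r by blast
  have "{conj_class x, conj_class y, conj_class w} = noncentral_classes G"
  proof (rule card_subset_eq)
    have "x \<noteq> \<one>" "y \<noteq> \<one>" "w \<noteq> \<one>"
      using x y w p q r by auto
    then show "{conj_class x, conj_class y, conj_class w} \<subseteq> noncentral_classes G"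
      using x y w by (simp add: noncentral_classes_eq[OF fin] center)
    have "conj_class u \<noteq> conj_class v" if "u \<in> carrier G" "v \<in> carrier G" "ord u \<noteq> ord v" for u v
      using that ord_conj_class conj_class_self by metis
    then show "card {conj_class x, conj_class y, conj_class w} = card (noncentral_classes G)"
      using x y w distinct card by simp
  qed (use CDE in simp)
  then have classes: "conj_class ` (carrier G - {\<one>}) = {conj_class x, conj_class y, conj_class w}"
    using noncentral_classes_eq[OF fin] center by simp
  have "u \<in> conj_class x \<union> conj_class y \<union> conj_class w" if "u \<in> carrier G - {\<one>}" for u
  proof -
    have "conj_class u \<in> {conj_class x, conj_class y, conj_class w}"
      using that classes by blast
    then show ?thesis
      using that conj_class_self[of u] by auto
  qed
  then have "carrier G = insert \<one> (conj_class x \<union> conj_class y \<union> conj_class w)"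
    using conj_class_subset x y w by blast
  then show False
    using not_three_classes_of_distinct_prime_orders[OF fin, of x y w] x y w p q r distinct by simp
qed

section \<open>Groups with nontrivial centre\<close>

text \<open>
  Let \<open>z\<close> be the order of the centre and \<open>m\<close> its index. The centralizer of a noncentral element
  properly contains the centre, so a noncentral class has a size that properly divides \<open>m\<close> and is at
  least 2; thus \<open>m \<ge> 4\<close> and the size is at most \<open>m / 2\<close>. The class equation yields
  \<open>z (m - 1) \<le> 3 m / 2\<close>, whose only solution with \<open>z \<ge> 2\<close> and \<open>m \<ge> 4\<close> is \<open>z = 2\<close>, \<open>m = 4\<close>.
\<close>

lemma order_8_if_three_noncentral_classes:
  assumes fin: "finite (carrier G)" and card: "card (noncentral_classes G) = 3"
    and nontriv: "card center \<noteq> 1"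
  shows "order G = 8"
proof -
  define z where "z = card center"
  have finZ: "finite center"
    using fin by (auto simp: center_def)
  have z2: "z \<ge> 2"
    using nontriv finZ one_mem_center unfolding z_def
    by (metis One_nat_def Suc_1 Suc_leI card_gt_0_iff empty_iff le_neq_implies_less)
  have "z dvd order G"
    using lagrange[OF subgroup_center] unfolding z_def by (metis dvd_triv_right)
  then obtain m where m: "order G = z * m" by auto
  have half: "2 \<le> card B \<and> 2 * card B \<le> m \<and> 4 \<le> m" if B: "B \<in> noncentral_classes G" for B
  proof -
    obtain x where x: "x \<in> carrier G" "x \<notin> center" "B = conj_class x"
      using B by (auto simp: noncentral_classes_eq[OF fin])
    let ?K = "G\<lparr>carrier := centralizer x\<rparr>"
    interpret K: group ?K
      using subgroup_centralizer[OF x(1)] subgroup.subgroup_is_group is_group by blast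
    have sub: "center \<subseteq> centralizer x"
      using x by (auto simp: center_def centralizer_def)
    have "subgroup center ?K"
      using subgroup_incl[OF subgroup_center subgroup_centralizer[OF x(1)] sub] .
    then have "card (rcosets\<^bsub>?K\<^esub> center) * z = card (centralizer x)"
      using K.lagrange[of center] by (simp add: z_def order_def)
    then have "z dvd card (centralizer x)"
      by (metis dvd_triv_right)
    then obtain k where k: "card (centralizer x) = z * k" by auto
    have "center \<subset> centralizer x"
      using sub x by (auto simp: centralizer_def)
    moreover have "finite (centralizer x)"
      using fin by (simp add: centralizer_def)
    ultimately have "z < z * k"
      using psubset_card_mono k unfolding z_def by metis
    then have k2: "k \<ge> 2" by (cases k) auto
    have "card B * (z * k) = z * m"
      using card_conj_class_mult_card_centralizer[OF x(1)] k m x(3) by simp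
    then have km: "card B * k = m"
      using z2 by simp
    have B2: "card B \<ge> 2"
      using B by (simp add: noncentral_classes_def)
    show ?thesis
      using km k2 B2 mult_le_mono2[OF k2, of "card B"] by linarith
  qed
  obtain C D E where CDE: "noncentral_classes G = {C, D, E}" "C \<noteq> D" "C \<noteq> E" "D \<noteq> E"
    using card by (auto simp: card_3_iff)
  have eq: "z * m = z + card C + card D + card E"
    using class_equation[OF fin] CDE m z_def by simp
  have bounds: "2 * card C \<le> m" "2 * card D \<le> m" "2 * card E \<le> m" "4 \<le> m"
    using half CDE by auto
  have le: "2 * (z * m) \<le> 2 * z + 3 * m"
    using eq bounds by linarith
  (* Substituting z = z' + 2 and m = m' + 4 turns the inequality into one that forces z' = m' = 0. *)
  obtain z' m' where zm': "z = z' + 2" "m = m' + 4"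
    using z2 bounds(4) by (metis add.commute le_Suc_ex)
  have "2 * (z' * m') + 6 * z' + m' \<le> 0"
    using le unfolding zm' by (simp add: algebra_simps)
  then show ?thesis
    using m zm' by simp
qed

end

section \<open>Nonabelian groups of order eight\<close>

text \<open>
  The pair \<open>(i, b)\<close> stands for \<open>r\<^sup>i s\<^sup>b\<close>, where \<open>r\<^sup>4 = \<one>\<close>, \<open>s r = r\<^sup>-\<^sup>1 s\<close> and \<open>s\<^sup>2 = r\<^sup>e\<close>. Associativity holds
  only when \<open>e\<close> is even; up to multiples of 4 this leaves \<open>e = 0\<close> for the dihedral and \<open>e = 2\<close> for the
  quaternion group. The common multiplication table lets one argument serve both.
\<close>

definition quarter_turn_mult :: "int \<Rightarrow> int \<times> bool \<Rightarrow> int \<times> bool \<Rightarrow> int \<times> bool" where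
  "quarter_turn_mult e = (\<lambda>(i, b) (j, c).
     (((if b then i - j else i + j) + (if b \<and> c then e else 0)) mod 4, b \<noteq> c))"

definition quarter_turn_extension :: "int \<Rightarrow> (int \<times> bool) monoid" where
  "quarter_turn_extension e =
     \<lparr>carrier = {0..<4} \<times> UNIV, monoid.mult = quarter_turn_mult e, one = (0, False)\<rparr>"

lemma D8_eq: "D8 = quarter_turn_extension 0"
  by (auto simp: D8_def dihedral_group_def quarter_turn_extension_def quarter_turn_mult_def fun_eq_iff)

context group
begin

lemma int_pow_mod_ord:
  assumes "x \<in> carrier G"
  shows "x [^] (i mod int (ord x)) = x [^] i"
  using int_pow_eq[OF assms] by (simp add: mod_eq_dvd_iff[symmetric])

lemma neq_inv_if_ord_gt_2:
  assumes "x \<in> carrier G" "ord x > 2"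
  shows "x \<noteq> inv x"
proof
  assume "x = inv x"
  then have "x [^] (2 :: nat) = \<one>"
    using assms(1) r_inv[of x] by (simp add: numeral_2_eq_2)
  then have "ord x dvd 2"
    using pow_eq_id assms(1) by blast
  then show False
    using assms(2) dvd_imp_le[of "ord x" 2] by simp
qed

lemma pow_mult_eq_powD:
  assumes "r \<in> carrier G" "s \<in> carrier G" "r [^] (k :: int) \<otimes> s = r [^] (l :: int)"
  shows "s = r [^] (l - k)"
proof -
  have "s = r [^] (- k) \<otimes> (r [^] k \<otimes> s)"
    using assms(1,2) by (simp add: int_pow_neg flip: m_assoc)
  also have "\<dots> = r [^] (- k + l)"
    unfolding assms(3) by (rule int_pow_mult[OF assms(1), symmetric])
  finally show ?thesis by simp
qed

text \<open>
  The relations determine how the products \<open>r\<^sup>i s\<^sup>b\<close> multiply, and they also make these products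
  distinct: as \<open>r\<close> differs from its inverse, \<open>s\<close> does not commute with \<open>r\<close> and so is no power of it.
  By counting, the products then exhaust the group.
\<close>

lemma iso_quarter_turn_extension:
  assumes ord8: "order G = 8" and r: "r \<in> carrier G" "ord r = 4" and s: "s \<in> carrier G"
    and conj: "s \<otimes> r = inv r \<otimes> s"
    and square: "s \<otimes> s = r [^] (e::int)"
  shows "G \<cong> quarter_turn_extension e"
proof -
  let ?M = "quarter_turn_extension e"
  let ?f = "\<lambda>(i::int, b). r [^] i \<otimes> (if b then s else \<one>)"
  have mod4: "r [^] (i mod 4) = r [^] i" for i :: int
    using int_pow_mod_ord[OF r(1)] r(2) by simp
  have "s \<otimes> r \<noteq> r \<otimes> s"
  proof
    assume "s \<otimes> r = r \<otimes> s"
    then have "r = inv r"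
      using conj r s by simp
    then show False
      using neq_inv_if_ord_gt_2[OF r(1)] r(2) by simp
  qed
  then have outside: "s \<noteq> r [^] i" for i :: int
    using int_pow_mult[OF r(1), of i 1] int_pow_mult[OF r(1), of 1 i] r
    by (auto simp: add.commute)
  have swap_nat: "s \<otimes> r [^] int n = r [^] (- int n) \<otimes> s" for n
  proof (induction n)
    case (Suc n)
    have "s \<otimes> r [^] int (Suc n) = s \<otimes> r [^] int n \<otimes> r"
      using r s int_pow_mult[OF r(1), of "int n" 1] by (simp add: m_assoc add.commute)
    also have "\<dots> = r [^] (- int n) \<otimes> (s \<otimes> r)"
      using Suc r s by (simp add: m_assoc)
    also have "\<dots> = r [^] (- int n) \<otimes> r [^] (- 1 :: int) \<otimes> s"
      unfolding conj using r s by (simp add: m_assoc int_pow_neg)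
    also have "r [^] (- int n) \<otimes> r [^] (- 1 :: int) = r [^] (- int (Suc n))"
      using int_pow_mult[OF r(1), of "- int n" "- 1"] by (simp add: add.commute)
    finally show ?case .
  qed (use s in simp)
  have swap: "s \<otimes> r [^] j = r [^] (- j) \<otimes> s" for j :: int
    using swap_nat[of "nat (j mod 4)"] mod4[of j] mod4[of "- j"] mod4[of "- (j mod 4)"]
    by (simp add: mod_minus_eq)
  have hom: "?f \<in> hom ?M G"
  proof (rule homI)
    show "?f u \<in> carrier G" for u
      using r s by (auto split: prod.split)
    show "?f (u \<otimes>\<^bsub>?M\<^esub> v) = ?f u \<otimes> ?f v" for u v
    proof -
      obtain i b j c where uv: "u = (i, b)" "v = (j, c)"
        by (cases u; cases v) blast
      have "r [^] i \<otimes> s \<otimes> r [^] j = r [^] (i - j) \<otimes> s"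
        using r s swap[of j] int_pow_mult[OF r(1), of i "- j"] by (simp add: m_assoc)
      moreover have "r [^] i \<otimes> s \<otimes> (r [^] j \<otimes> s) = r [^] i \<otimes> s \<otimes> r [^] j \<otimes> s"
        using r s by (simp add: m_assoc)
      moreover have "r [^] (i - j) \<otimes> s \<otimes> s = r [^] (i - j + e)"
        using r s square by (simp add: m_assoc int_pow_mult)
      moreover have "r [^] i \<otimes> (r [^] j \<otimes> s) = r [^] (i + j) \<otimes> s"
        using r s by (simp add: m_assoc int_pow_mult)
      ultimately show ?thesis
        using r s by (simp add: uv quarter_turn_extension_def quarter_turn_mult_def mod4 int_pow_mult)
    qed
  qed
  have inj: "inj_on ?f (carrier ?M)"
  proof (rule inj_onI)
    fix u v assume u: "u \<in> carrier ?M" and v: "v \<in> carrier ?M" and eq: "?f u = ?f v"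
    obtain i b j c where uv: "u = (i, b)" "v = (j, c)"
      by (cases u; cases v) blast
    have outside': "r [^] k \<otimes> s \<noteq> r [^] l" for k l :: int
      using pow_mult_eq_powD[OF r(1) s] outside by metis
    have bc: "b = c"
      using eq outside'[of i j] outside'[of j i] r s by (auto simp: uv split: if_splits)
    then have "r [^] i = r [^] j"
      using eq r s by (auto simp: uv split: if_splits)
    then have "4 dvd j - i"
      using r int_pow_eq by auto
    moreover have "0 \<le> i" "i < 4" "0 \<le> j" "j < 4"
      using u v by (auto simp: uv quarter_turn_extension_def)
    ultimately have "i = j"
      by presburger
    then show "u = v"
      using bc uv by simp
  qed
  have "?f ` carrier ?M = carrier G"
  proof (rule card_subset_eq)
    show "finite (carrier G)"
      using ord8 by (metis order_gt_0_iff_finite zero_less_numeral)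
    show "?f ` carrier ?M \<subseteq> carrier G"
      using r s by (auto split: prod.split)
    have "card (carrier ?M) = 8"
      by (simp add: quarter_turn_extension_def card_cartesian_product)
    then show "card (?f ` carrier ?M) = card (carrier G)"
      using card_image[OF inj] ord8 by (simp add: order_def)
  qed
  then have bij: "bij_betw ?f (carrier ?M) (carrier G)"
    using inj by (simp add: bij_betw_def)
  (* The model is not known to be a group at this point, so the inverse of the bijection is checked to
     be a homomorphism by hand. *)
  let ?g = "inv_into (carrier ?M) ?f"
  have "?g \<in> hom G ?M"
  proof (rule homI)
    fix x y assume xy: "x \<in> carrier G" "y \<in> carrier G"
    then have gM: "?g x \<in> carrier ?M" "?g y \<in> carrier ?M"
      using bij_betw_inv_into[OF bij] bij_betwE by blast+
    then show "?g x \<in> carrier ?M" by simp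
    have "x \<otimes> y = ?f (?g x \<otimes>\<^bsub>?M\<^esub> ?g y)"
      using hom_mult[OF hom gM] bij_betw_inv_into_right[OF bij] xy by simp
    moreover have "?g x \<otimes>\<^bsub>?M\<^esub> ?g y \<in> carrier ?M"
      by (cases "?g x"; cases "?g y") (simp add: quarter_turn_extension_def quarter_turn_mult_def)
    ultimately show "?g (x \<otimes> y) = ?g x \<otimes>\<^bsub>?M\<^esub> ?g y"
      using inv_into_f_f[OF inj] by simp
  qed
  then show ?thesis
    using bij_betw_inv_into[OF bij] by (intro is_isoI isoI)
qed

text \<open>
  Not all squares are \<open>\<one>\<close> and the group is not cyclic, so there is an element \<open>r\<close> of order 4. Its powers
  have index 2; let \<open>s\<close> be outside them. The product \<open>s r\<close> lies in the other coset, so it is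
  \<open>r\<^sup>k s\<close> for some \<open>k\<close>, and \<open>k\<close> must be 3 modulo 4: the residue 1 would make the group commutative, and
  0 and 2 would lower the order of \<open>r\<close>. Finally \<open>s\<^sup>2\<close> is a power of \<open>r\<close> that commutes with \<open>s\<close>, which
  leaves only \<open>\<one>\<close> and \<open>r\<^sup>2\<close>.
\<close>

lemma nonabelian_order_8_cases:
  assumes ord8: "order G = 8" and nonab: "\<exists>x \<in> carrier G. \<exists>y \<in> carrier G. x \<otimes> y \<noteq> y \<otimes> x"
  shows "G \<cong> quarter_turn_extension 0 \<or> G \<cong> quarter_turn_extension 2"
proof -
  have fin: "finite (carrier G)"
    using ord8 by (metis order_gt_0_iff_finite zero_less_numeral)
  have ord_cases: "ord x \<in> {1, 2, 4, 8}" if "x \<in> carrier G" for x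
  proof -
    have "ord x dvd 8"
      using ord_dvd_group_order[OF that] ord8 by simp
    then have "ord x \<le> 8" "ord x \<noteq> 0"
      using dvd_imp_le[of "ord x" 8] by (auto intro: gr0I)
    then have "ord x \<in> {1, 2, 3, 4, 5, 6, 7, 8}" by auto
    with \<open>ord x dvd 8\<close> show ?thesis by auto
  qed
  obtain r where r: "r \<in> carrier G" "ord r = 4"
  proof -
    obtain r where r: "r \<in> carrier G" "ord r \<noteq> 1" "ord r \<noteq> 2"
    proof -
      have "\<exists>r \<in> carrier G. ord r \<noteq> 1 \<and> ord r \<noteq> 2"
      proof (rule ccontr)
        assume "\<not> ?thesis"
        then have "x [^] (2 :: nat) = \<one>" if "x \<in> carrier G" for x
          using that pow_eq_id[OF that, of 2] by auto
        then have invol: "inv x = x" if "x \<in> carrier G" for x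
          using that by (simp add: inv_equality numeral_2_eq_2)
        then have "x \<otimes> y = y \<otimes> x" if "x \<in> carrier G" "y \<in> carrier G" for x y
          using that by (metis inv_mult_group m_closed)
        then show False
          using nonab by blast
      qed
      then show ?thesis using that by blast
    qed
    have "ord r \<noteq> 8"
    proof
      assume "ord r = 8"
      then have "generate G {r} = carrier G"
        using generate_pow_card[OF r(1)] ord8 fin generate_incl[of "{r}"] r(1)
        by (intro card_subset_eq) (auto simp: order_def)
      then have "\<exists>i :: int. x = r [^] i" if "x \<in> carrier G" for x
        using that generate_pow[OF r(1)] by auto
      then have "x \<otimes> y = y \<otimes> x" if "x \<in> carrier G" "y \<in> carrier G" for x y
        using that r(1) by (metis add.commute int_pow_mult)
      then show False
        using nonab by blast
    qed
    then show ?thesis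
      using that r ord_cases[of r] by auto
  qed
  let ?R = "generate G {r}"
  have R: "?R = {r [^] i | i :: int. True}"
    using generate_pow[OF r(1)] by auto
  have cardR: "card ?R = 4"
    using generate_pow_card r by simp
  have RG: "?R \<subseteq> carrier G"
    using generate_incl[of "{r}"] r by simp
  then have finR: "finite ?R"
    using fin finite_subset by blast
  have "?R \<noteq> carrier G"
    using cardR ord8 by (auto simp: order_def)
  then obtain s where s: "s \<in> carrier G" "s \<notin> ?R"
    using RG by blast
  have outside: "s \<noteq> r [^] i" for i :: int
    using s R by blast
  have outside': "r [^] k \<otimes> s \<noteq> r [^] l" for k l :: int
    using pow_mult_eq_powD[OF r(1)] s outside by metis
  have cover: "carrier G = ?R \<union> (\<lambda>x. x \<otimes> s) ` ?R"
  proof (rule sym, rule card_subset_eq)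
    show "?R \<union> (\<lambda>x. x \<otimes> s) ` ?R \<subseteq> carrier G"
      using RG s by auto
    have "card ((\<lambda>x. x \<otimes> s) ` ?R) = 4"
      using RG s cardR by (subst card_image) (auto simp: inj_on_def subset_iff)
    moreover have "?R \<inter> (\<lambda>x. x \<otimes> s) ` ?R = {}"
      using outside' R by fastforce
    ultimately show "card (?R \<union> (\<lambda>x. x \<otimes> s) ` ?R) = card (carrier G)"
      using finR cardR ord8 by (simp add: card_Un_disjoint order_def)
  qed (rule fin)
  have centralizer_full: "centralizer x = carrier G"
    if "r \<in> centralizer x" "s \<in> centralizer x" "x \<in> carrier G" for x
  proof
    have sub: "subgroup (centralizer x) G"
      using subgroup_centralizer that by blast
    have "?R \<subseteq> centralizer x"
      using generate_subgroup_incl[OF _ sub, of "{r}"] that by simp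
    then show "carrier G \<subseteq> centralizer x"
      unfolding cover using subgroup.m_closed[OF sub] that by blast
  qed (simp add: centralizer_def)
  have noncomm: "s \<otimes> r \<noteq> r \<otimes> s"
  proof
    assume "s \<otimes> r = r \<otimes> s"
    then have "centralizer r = carrier G" "centralizer s = carrier G"
      using centralizer_full r s by (auto simp: centralizer_def)
    then have "x \<in> centralizer r" "x \<in> centralizer s" if "x \<in> carrier G" for x
      using that by simp_all
    then have "r \<in> centralizer x" "s \<in> centralizer x" if "x \<in> carrier G" for x
      using that r(1) s(1) by (simp_all add: centralizer_def)
    then have "centralizer x = carrier G" if "x \<in> carrier G" for x
      using that centralizer_full by blast
    then show False
      using nonab by (auto simp: centralizer_def)
  qed
  have mod4: "r [^] (i mod 4) = r [^] i" for i :: int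
    using int_pow_mod_ord[OF r(1)] r(2) by simp
  have r_inv: "r \<noteq> inv r"
    using neq_inv_if_ord_gt_2[OF r(1)] r(2) by simp
  have r2: "r \<otimes> r \<noteq> \<one>"
    using r_inv r(1) by (metis inv_equality)
  have conj: "s \<otimes> r = inv r \<otimes> s"
  proof -
    have "s \<otimes> r \<notin> ?R"
    proof
      assume "s \<otimes> r \<in> ?R"
      then obtain l :: int where "s \<otimes> r = r [^] l"
        using R by blast
      moreover have "s = (s \<otimes> r) \<otimes> inv r"
        using r s by (simp add: m_assoc)
      ultimately have "s = r [^] (l - 1)"
        using int_pow_diff[OF r(1), of l 1] r by simp
      then show False
        using outside by blast
    qed
    moreover have "s \<otimes> r \<in> ?R \<union> (\<lambda>x. x \<otimes> s) ` ?R"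
      using r s unfolding cover[symmetric] by simp
    ultimately have "s \<otimes> r \<in> (\<lambda>x. x \<otimes> s) ` ?R"
      by blast
    then obtain k :: int where "s \<otimes> r = r [^] k \<otimes> s"
      unfolding R by blast
    then have k: "s \<otimes> r = r [^] (k mod 4) \<otimes> s"
      by (simp add: mod4)
    have "k mod 4 \<noteq> 0"
      using k r s by (auto simp: r_cancel_one')
    moreover have "k mod 4 \<noteq> 1"
      using k noncomm r by auto
    moreover have "k mod 4 \<noteq> 2"
    proof
      assume "k mod 4 = 2"
      then have sr: "s \<otimes> r = r [^] (2 :: int) \<otimes> s"
        using k by simp
      have "s \<otimes> (r \<otimes> r) = r [^] (2 :: int) \<otimes> (s \<otimes> r)"
        using sr r s by (metis int_pow_closed m_assoc)
      also have "\<dots> = r [^] (2 :: int) \<otimes> r [^] (2 :: int) \<otimes> s"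
        unfolding sr using r s by (simp add: m_assoc)
      also have "r [^] (2 :: int) \<otimes> r [^] (2 :: int) = \<one>"
        using r int_pow_mult[OF r(1), of 2 2] int_pow_eq_id[OF r(1), of 4] by simp
      finally show False
        using r2 r s by simp
    qed
    ultimately have "k mod 4 = 3" by presburger
    then have "r [^] (k mod 4) = r [^] (- 1 :: int)"
      using mod4[of "- 1"] by simp
    then show ?thesis
      using k r by (simp add: int_pow_neg)
  qed
  have "s \<otimes> s \<notin> (\<lambda>x. x \<otimes> s) ` ?R"
    using s RG by auto
  moreover have "s \<otimes> s \<in> ?R \<union> (\<lambda>x. x \<otimes> s) ` ?R"
    using s unfolding cover[symmetric] by simp
  ultimately have "s \<otimes> s \<in> ?R"
    by blast
  then obtain e :: int where "s \<otimes> s = r [^] e"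
    unfolding R by blast
  then have e: "s \<otimes> s = r [^] (e mod 4)"
    by (simp add: mod4)
  have "e mod 4 \<noteq> 1"
  proof
    assume "e mod 4 = 1"
    then have "s \<otimes> s = r"
      using e r by simp
    then show False
      using noncomm s m_assoc by metis
  qed
  moreover have "e mod 4 \<noteq> 3"
  proof
    assume "e mod 4 = 3"
    then have "s \<otimes> s = inv r"
      using e mod4[of "- 1"] r by (simp add: int_pow_neg)
    then have "s \<otimes> r = s \<otimes> inv r"
      using conj s m_assoc by metis
    then show False
      using r s r_inv by simp
  qed
  ultimately have "e mod 4 = 0 \<or> e mod 4 = 2"
    by presburger
  then show ?thesis
    using iso_quarter_turn_extension[OF ord8 r s(1) conj] e by metis
qed

end

lemma Q8_iso: "Q8 \<cong> quarter_turn_extension 2"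
proof -
  interpret Q: group Q8 by (rule group_Q8)
  let ?r = "(0, 1, 0, 0)" and ?s = "(0, 0, 1, 0)"
  have pow: "?r [^]\<^bsub>Q8\<^esub> (2 :: nat) = (- 1, 0, 0, 0)" "?r [^]\<^bsub>Q8\<^esub> (4 :: nat) = \<one>\<^bsub>Q8\<^esub>"
    by (simp_all add: nat_pow_def Q8_def numeral_eq_Suc)
  have r: "?r \<in> carrier Q8" and s: "?s \<in> carrier Q8"
    by (simp_all add: Q8_def)
  have "(- 1, 0, 0, 0) \<noteq> \<one>\<^bsub>Q8\<^esub>"
    by (simp add: Q8_def)
  then have "Q.ord ?r dvd 4" "\<not> Q.ord ?r dvd 2"
    using pow Q.pow_eq_id[OF r] \<open>(- 1, 0, 0, 0) \<noteq> \<one>\<^bsub>Q8\<^esub>\<close> by metis+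
  moreover from this have "Q.ord ?r \<in> {0, 1, 2, 3, 4}"
    using dvd_imp_le[of "Q.ord ?r" 4] by auto
  ultimately have ord: "Q.ord ?r = 4"
    by auto
  have "inv\<^bsub>Q8\<^esub> ?r = (0, - 1, 0, 0)"
    by (rule Q.inv_equality) (simp_all add: Q8_def)
  then have "?s \<otimes>\<^bsub>Q8\<^esub> ?r = inv\<^bsub>Q8\<^esub> ?r \<otimes>\<^bsub>Q8\<^esub> ?s"
    by (simp add: Q8_def)
  moreover have "?s \<otimes>\<^bsub>Q8\<^esub> ?s = ?r [^]\<^bsub>Q8\<^esub> (2 :: int)"
    using pow(1) int_pow_int[where x = ?r and n = 2 and G = Q8] by (simp add: Q8_def)
  ultimately show ?thesis
    using Q.iso_quarter_turn_extension[OF order_Q8 r ord s] by blast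
qed

theorem theoremB:
  fixes G :: "('a, 'b) monoid_scheme"
  assumes "group G" and "finite (carrier G)"
    and "complete_digraph 3 (with_proj (class_graph G))"
  shows "G \<cong> Q8 \<or> G \<cong> D8"
proof -
  interpret group G by fact
  have verts: "card (noncentral_classes G) = 3"
    and edges: "\<And>C D. C \<in> noncentral_classes G \<Longrightarrow> D \<in> noncentral_classes G \<Longrightarrow> C \<noteq> D \<Longrightarrow>
      \<not> coprime (card C) (card D)"
    using assms(3) unfolding complete_digraph_pair_def by (auto simp: class_graph_def)
  have "card center \<noteq> 1"
    using center_nontrivial_if_three_noncoprime_classes[OF assms(2) verts] edges by blast
  then have ord8: "order G = 8"
    using order_8_if_three_noncentral_classes[OF assms(2) verts] by blast
  have "carrier G \<noteq> center"
    using verts by (auto simp: noncentral_classes_eq[OF assms(2)])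
  then have "\<exists>x \<in> carrier G. \<exists>y \<in> carrier G. x \<otimes>\<^bsub>G\<^esub> y \<noteq> y \<otimes>\<^bsub>G\<^esub> x"
    by (auto simp: center_def)
  then have "G \<cong> quarter_turn_extension 0 \<or> G \<cong> quarter_turn_extension 2"
    using nonabelian_order_8_cases[OF ord8] by blast
  then show ?thesis
    using D8_eq group.iso_sym[OF group_Q8 Q8_iso] iso_trans by metis
qed

end
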